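(* Let $(X,d)$ be a complete metric space, $m\in\mathbb N$, and let $\mathcal S=(X,(\phi_j)_{j=1}^L)$ be a GIFS of order $m$ on $X$ consisting of generalized Banach contractions, with attractor $A_{\mathcal S}$. Let $\varepsilon>0$, let $\hat X$ be a proper $\varepsilon$-net of $X$, let $r:X\to\hat X$ be an $\varepsilon$-projection, and let $\hat{\mathcal S}=(\hat X,(\hat\phi_j)_{j=1}^L)$, where $\hat\phi_j:=(r\circ\phi_j)_{|\hat X^m}:\hat X^m\to\hat X$ for $j=1,\dots,L$. Then for any $K\in\mathcal K^*(\hat X)$ and every $n\in\mathbb N$, $$h\big(\overline F_{\hat{\mathcal S}}^{\,n}(K),A_{\mathcal S}\big)\le\frac{5\varepsilon}{1-\alpha_{\mathcal S}}+\alpha_{\mathcal S}^{\,n}\,h(K,A_{\mathcal S}).$$ In particular, there is $n_0\in\mathbb N$ such that for every $n\ge n_0$, $\overline F_{\hat{\mathcal S}}^{\,n}(K)$ is an attractor of $\mathcal S$ with resolution $\frac{6\varepsilon}{1-\alpha_{\mathcal S}}$.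
   Context: $X^m$ is the Cartesian product of $m$ copies of $X$ with the maximum metric $d_m((x_i),(y_i))=\max_i d(x_i,y_i)$. A generalized Banach contraction is a map $f:X^m\to X$ with Lipschitz constant $\operatorname{Lip}(f)<1$ (with respect to $d_m$ and $d$). $\mathcal K^*(X)$ is the family of nonempty compact subsets of $X$, with the Hausdorff metric $h$. A generalized iterated function system (GIFS) of order $m$, $\mathcal S=(X,(\phi_j)_{j=1}^L)$, is a finite family of continuous maps $\phi_j:X^m\to X$. Its operator $F_{\mathcal S}:\mathcal K^*(X)^m\to\mathcal K^*(X)$ is $F_{\mathcal S}(K_0,\dots,K_{m-1})=\bigcup_{j=1}^L\phi_j(K_0\times\dots\times K_{m-1})$, and $\overline F_{\mathcal S}:\mathcal K^*(X)\to\mathcal K^*(X)$ is $\overline F_{\mathcal S}(K)=F_{\mathcal S}(K,\dots,K)$. The attractor of $\mathcal S$ is the unique $A_{\mathcal S}\in\mathcal K^*(X)$ with $A_{\mathcal S}=F_{\mathcal S}(A_{\mathcal S},\dots,A_{\mathcal S})$ and such that for all $K_0,\dots,K_{m-1}\in\mathcal K^*(X)$ the sequence $K_{k+m}:=F_{\mathcal S}(K_k,\dots,K_{k+m-1})$, $k\ge0$, converges to $A_{\mathcal S}$; it exists when $X$ is (nonempty and) complete and the $\phi_j$ are generalized Banach contractions. $\alpha_{\mathcal S}:=\max_j\operatorname{Lip}(\phi_j)$. For $\delta>0$, $A_\delta\in\mathcal K^*(X)$ is an attractor of $\mathcal S$ with resolution $\delta$ if $h(A_\delta,A_{\mathcal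 S})\le\delta$. A subset $\hat X\subset X$ is an $\varepsilon$-net of $X$ if for every $x\in X$ there is $y\in\hat X$ with $d(x,y)\le\varepsilon$; it is proper if $D\cap\hat X$ is finite for every bounded $D\subset X$. An $\varepsilon$-projection is a map $r:X\to\hat X$ with $r(x)=x$ for $x\in\hat X$ and $d(x,r(x))\le\varepsilon$ for all $x\in X$. Elements of $\mathcal K^*(\hat X)$ are viewed as elements of $\mathcal K^*(X)$. *)

theory Defs
  imports "HOL-Analysis.Analysis"
begin

text \<open>Every notion is relative to a carrier set \<open>X\<close> in an ambient metric space, so that the same
  definitions apply to systems on \<open>X\<close> and on a net inside \<open>X\<close>. Points of \<open>X\<^sup>m\<close> are extensional
  functions on \<open>{..<m}\<close>.\<close>

definition cart_power :: "'a set \<Rightarrow> nat \<Rightarrow> (nat \<Rightarrow> 'a) set" where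
  "cart_power X m = (\<Pi>\<^sub>E i\<in>{..<m}. X)"

definition max_dist :: "nat \<Rightarrow> (nat \<Rightarrow> 'a::metric_space) \<Rightarrow> (nat \<Rightarrow> 'a) \<Rightarrow> real" where
  "max_dist m x y = Max ((\<lambda>i. dist (x i) (y i)) ` {..<m})"

lemma Metric_space_max_dist:
  assumes "1 \<le> m"
  shows "Metric_space (cart_power X m) (max_dist m)"
proof
  have ne: "{..<m} \<noteq> {}" using assms by (auto simp: lessThan_empty_iff)
  have ge: "dist (x i) (y i) \<le> max_dist m x y" if "i < m" for x y :: "nat \<Rightarrow> 'a" and i
    unfolding max_dist_def using that by (intro Max_ge) auto
  show nonneg: "0 \<le> max_dist m x y" for x y :: "nat \<Rightarrow> 'a"
    using ge[of 0 x y] assms by (smt (verit) zero_le_dist less_eq_Suc_le One_nat_def)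
  show "max_dist m x y = max_dist m y x" for x y :: "nat \<Rightarrow> 'a"
    by (simp add: max_dist_def dist_commute)
  show "max_dist m x y = 0 \<longleftrightarrow> x = y"
    if "x \<in> cart_power X m" "y \<in> cart_power X m" for x y
  proof
    assume 0: "max_dist m x y = 0"
    have "x i = y i" if "i < m" for i
      using ge[OF that, of x y] 0 by simp
    then show "x = y"
      using that unfolding cart_power_def by (intro PiE_ext[of _ "{..<m}"]) auto
  next
    assume "x = y"
    then show "max_dist m x y = 0"
      using ne by (simp add: max_dist_def image_constant_conv)
  qed
  show "max_dist m x z \<le> max_dist m x y + max_dist m y z" for x y z :: "nat \<Rightarrow> 'a"
  proof -
    have "dist (x i) (z i) \<le> max_dist m x y + max_dist m y z" if "i < m" for i
      using ge[OF that, of x y] ge[OF that, of y z] dist_triangle[of "x i" "z i" "y i"] by linarith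
    then show ?thesis
      using ne by (subst (1) max_dist_def) (auto intro!: Max.boundedI)
  qed
qed

definition lipschitz_bound ::
  "'a::metric_space set \<Rightarrow> nat \<Rightarrow> ((nat \<Rightarrow> 'a) \<Rightarrow> 'a) \<Rightarrow> real \<Rightarrow> bool" where
  "lipschitz_bound X m f C \<longleftrightarrow> 0 \<le> C \<and>
     (\<forall>x\<in>cart_power X m. \<forall>y\<in>cart_power X m. dist (f x) (f y) \<le> C * max_dist m x y)"

text \<open>Meaningful only for Lipschitz maps: otherwise the infimum is over the empty set.\<close>

definition Lip :: "'a::metric_space set \<Rightarrow> nat \<Rightarrow> ((nat \<Rightarrow> 'a) \<Rightarrow> 'a) \<Rightarrow> real" where
  "Lip X m f = Inf {C. lipschitz_bound X m f C}"

definition generalized_Banach_contraction ::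
  "'a::metric_space set \<Rightarrow> nat \<Rightarrow> ((nat \<Rightarrow> 'a) \<Rightarrow> 'a) \<Rightarrow> bool" where
  "generalized_Banach_contraction X m f \<longleftrightarrow>
     f \<in> cart_power X m \<rightarrow> X \<and> (\<exists>C. lipschitz_bound X m f C) \<and> Lip X m f < 1"

definition Kstar :: "'a::metric_space set \<Rightarrow> 'a set set" where
  "Kstar X = {K. K \<subseteq> X \<and> K \<noteq> {} \<and> compact K}"

definition hausdorff_metric :: "'a::metric_space set \<Rightarrow> 'a set \<Rightarrow> real" where
  "hausdorff_metric A B = max (SUP a\<in>A. infdist a B) (SUP b\<in>B. infdist b A)"

text \<open>The maps of a system are \<open>gifs_map S j\<close> for \<open>j \<in> {1..gifs_num S}\<close>.\<close>

record 'a gifs =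
  gifs_space :: "'a set"
  gifs_order :: nat
  gifs_num :: nat
  gifs_map :: "nat \<Rightarrow> (nat \<Rightarrow> 'a) \<Rightarrow> 'a"

definition is_GIFS :: "'a::metric_space gifs \<Rightarrow> bool" where
  "is_GIFS S \<longleftrightarrow> 1 \<le> gifs_order S \<and> 1 \<le> gifs_num S \<and>
     (\<forall>j\<in>{1..gifs_num S}.
        continuous_map
          (Metric_space.mtopology (cart_power (gifs_space S) (gifs_order S)) (max_dist (gifs_order S)))
          (top_of_set (gifs_space S)) (gifs_map S j))"

definition gifs_op :: "'a gifs \<Rightarrow> (nat \<Rightarrow> 'a set) \<Rightarrow> 'a set" where
  "gifs_op S K = (\<Union>j\<in>{1..gifs_num S}. gifs_map S j ` (\<Pi>\<^sub>E i\<in>{..<gifs_order S}. K i))"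

definition gifs_op_diag :: "'a gifs \<Rightarrow> 'a set \<Rightarrow> 'a set" where
  "gifs_op_diag S K = gifs_op S (\<lambda>_. K)"

definition is_attractor :: "'a::metric_space gifs \<Rightarrow> 'a set \<Rightarrow> bool" where
  "is_attractor S A \<longleftrightarrow> A \<in> Kstar (gifs_space S) \<and> A = gifs_op S (\<lambda>_. A) \<and>
     (\<forall>K. (\<forall>i<gifs_order S. K i \<in> Kstar (gifs_space S)) \<and>
          (\<forall>k. K (k + gifs_order S) = gifs_op S (\<lambda>i. K (k + i))) \<longrightarrow>
          (\<lambda>k. hausdorff_metric (K k) A) \<longlonglongrightarrow> 0)"

definition attractor :: "'a::metric_space gifs \<Rightarrow> 'a set" where
  "attractor S = (THE A. is_attractor S A)"

definition gifs_factor :: "'a::metric_space gifs \<Rightarrow> real" where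
  "gifs_factor S = Max ((\<lambda>j. Lip (gifs_space S) (gifs_order S) (gifs_map S j)) ` {1..gifs_num S})"

definition attractor_with_resolution ::
  "'a::metric_space gifs \<Rightarrow> real \<Rightarrow> 'a set \<Rightarrow> bool" where
  "attractor_with_resolution S \<delta> A \<longleftrightarrow>
     0 < \<delta> \<and> A \<in> Kstar (gifs_space S) \<and> hausdorff_metric A (attractor S) \<le> \<delta>"

definition eps_net :: "real \<Rightarrow> 'a::metric_space set \<Rightarrow> 'a set \<Rightarrow> bool" where
  "eps_net \<epsilon> X N \<longleftrightarrow> N \<subseteq> X \<and> (\<forall>x\<in>X. \<exists>y\<in>N. dist x y \<le> \<epsilon>)"

definition proper_eps_net :: "real \<Rightarrow> 'a::metric_space set \<Rightarrow> 'a set \<Rightarrow> bool" where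
  "proper_eps_net \<epsilon> X N \<longleftrightarrow> eps_net \<epsilon> X N \<and> (\<forall>D. D \<subseteq> X \<and> bounded D \<longrightarrow> finite (D \<inter> N))"

definition eps_projection ::
  "real \<Rightarrow> 'a::metric_space set \<Rightarrow> 'a set \<Rightarrow> ('a \<Rightarrow> 'a) \<Rightarrow> bool" where
  "eps_projection \<epsilon> X N r \<longleftrightarrow>
     r \<in> X \<rightarrow> N \<and> (\<forall>x\<in>N. r x = x) \<and> (\<forall>x\<in>X. dist x (r x) \<le> \<epsilon>)"

definition discretize :: "'a gifs \<Rightarrow> 'a set \<Rightarrow> ('a \<Rightarrow> 'a) \<Rightarrow> 'a gifs" where
  "discretize S N r =
     \<lparr>gifs_space = N, gifs_order = gifs_order S, gifs_num = gifs_num S,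
      gifs_map = (\<lambda>j. restrict (r \<circ> gifs_map S j) (cart_power N (gifs_order S)))\<rparr>"

end

theory Submission
  imports Defs
begin

text \<open>The operator of a system with factor \<open>\<alpha> < 1\<close> contracts the Hausdorff metric by \<open>\<alpha>\<close>. Its
  attractor is obtained without the completeness of the hyperspace: if \<open>x\<close> is the fixed point of
  \<open>x \<mapsto> \<phi>\<^sub>1(x, \<dots>, x)\<close>, then the finite sets obtained by iterating the operator on \<open>{x}\<close> increase, and
  the closure of their union is compact and invariant. For a subset \<open>K\<close> of the net, the
  discretized operator sends \<open>K\<close> to the \<open>r\<close>-image of \<open>gifs_op_diag S K\<close>, so each step costs an
  error of at most \<open>\<epsilon>\<close>, and the geometric series sums to \<open>\<epsilon> / (1 - \<alpha>)\<close>. This gives the estimate with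
  \<open>1\<close> in place of \<open>5\<close>.\<close>

section \<open>The Hausdorff metric on compact sets\<close>

text \<open>Compactness of \<open>A\<close> bounds the supremum, so it can be tested term by term;
  compactness of \<open>B\<close> turns each infimum into a minimum, attained at a point of
  \<open>B\<close>.\<close>

lemma SUP_infdist_le_iff:
  fixes A B :: "'a::metric_space set"
  assumes "compact A" "A \<noteq> {}" "compact B" "B \<noteq> {}"
  shows "(SUP a\<in>A. infdist a B) \<le> t \<longleftrightarrow> (\<forall>a\<in>A. \<exists>b\<in>B. dist a b \<le> t)"
proof -
  have "continuous_on A (\<lambda>a. infdist a B)"
    by (intro continuous_intros)
  then have "bdd_above ((\<lambda>a. infdist a B) ` A)"
    using assms(1) by (intro bounded_imp_bdd_above compact_imp_bounded compact_continuous_image)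
  then have "(SUP a\<in>A. infdist a B) \<le> t \<longleftrightarrow> (\<forall>a\<in>A. infdist a B \<le> t)"
    using assms(2) by (intro cSUP_le_iff) auto
  moreover have "infdist a B \<le> t \<longleftrightarrow> (\<exists>b\<in>B. dist a b \<le> t)" for a
  proof
    assume le: "infdist a B \<le> t"
    have "continuous_on B (dist a)"
      by (intro continuous_intros)
    then obtain b where b: "b \<in> B" "\<And>y. y \<in> B \<Longrightarrow> dist a b \<le> dist a y"
      using continuous_attains_inf[OF assms(3,4)] by blast
    then have "dist a b \<le> infdist a B"
      using assms(4) by (auto simp: infdist_def intro!: cINF_greatest)
    with b le show "\<exists>b\<in>B. dist a b \<le> t"
      by force
  qed (auto intro: infdist_le2)
  ultimately show ?thesis
    by simp
qed

text \<open>The carriers \<open>X\<close> and \<open>Y\<close> are independent, so that compact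
  subsets of the net can be compared directly with compact subsets of the whole space.\<close>

lemma hausdorff_metric_le_iff:
  fixes A B :: "'a::metric_space set"
  assumes "A \<in> Kstar X" "B \<in> Kstar Y"
  shows "hausdorff_metric A B \<le> t \<longleftrightarrow>
    (\<forall>a\<in>A. \<exists>b\<in>B. dist a b \<le> t) \<and> (\<forall>b\<in>B. \<exists>a\<in>A. dist b a \<le> t)"
  using assms by (simp add: hausdorff_metric_def SUP_infdist_le_iff Kstar_def)

lemma hausdorff_metric_commute: "hausdorff_metric A B = hausdorff_metric B A"
  by (simp add: hausdorff_metric_def max.commute)

lemma hausdorff_metric_leI:
  fixes A B :: "'a::metric_space set"
  assumes "A \<in> Kstar X" "B \<in> Kstar Y"
    and "\<And>a. a \<in> A \<Longrightarrow> \<exists>b\<in>B. dist a b \<le> t"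
    and "\<And>b. b \<in> B \<Longrightarrow> \<exists>a\<in>A. dist b a \<le> t"
  shows "hausdorff_metric A B \<le> t"
  by (rule iffD2[OF hausdorff_metric_le_iff[OF assms(1,2)]], intro conjI ballI; erule assms)

lemma hausdorff_metric_leD:
  fixes A B :: "'a::metric_space set"
  assumes "A \<in> Kstar X" "B \<in> Kstar Y" "hausdorff_metric A B \<le> t"
  shows "a \<in> A \<Longrightarrow> \<exists>b\<in>B. dist a b \<le> t" and "b \<in> B \<Longrightarrow> \<exists>a\<in>A. dist b a \<le> t"
  using assms(3) unfolding hausdorff_metric_le_iff[OF assms(1,2)] by blast+

lemma hausdorff_metric_nonneg:
  assumes "A \<in> Kstar X" "B \<in> Kstar Y"
  shows "0 \<le> hausdorff_metric A B"
proof -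
  obtain a where "a \<in> A" using assms(1) by (auto simp: Kstar_def)
  then obtain b where "dist a b \<le> hausdorff_metric A B"
    using hausdorff_metric_leD(1)[OF assms order_refl] by blast
  then show ?thesis
    by (rule order_trans[OF zero_le_dist])
qed

lemma hausdorff_metric_triangle:
  assumes "A \<in> Kstar X" "B \<in> Kstar Y" "C \<in> Kstar Z"
  shows "hausdorff_metric A C \<le> hausdorff_metric A B + hausdorff_metric B C"
proof (rule hausdorff_metric_leI[OF assms(1,3)])
  fix a assume "a \<in> A"
  then obtain b where b: "b \<in> B" "dist a b \<le> hausdorff_metric A B"
    using hausdorff_metric_leD(1)[OF assms(1,2) order_refl] by blast
  then obtain c where c: "c \<in> C" "dist b c \<le> hausdorff_metric B C"
    using hausdorff_metric_leD(1)[OF assms(2,3) order_refl] by blast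
  have "dist a c \<le> hausdorff_metric A B + hausdorff_metric B C"
    using b(2) c(2) dist_triangle[of a c b] by linarith
  with c(1) show "\<exists>c\<in>C. dist a c \<le> hausdorff_metric A B + hausdorff_metric B C" ..
next
  fix c assume "c \<in> C"
  then obtain b where b: "b \<in> B" "dist c b \<le> hausdorff_metric B C"
    using hausdorff_metric_leD(2)[OF assms(2,3) order_refl] by blast
  then obtain a where a: "a \<in> A" "dist b a \<le> hausdorff_metric A B"
    using hausdorff_metric_leD(2)[OF assms(1,2) order_refl] by blast
  have "dist c a \<le> hausdorff_metric A B + hausdorff_metric B C"
    using b(2) a(2) dist_triangle[of c a b] by linarith
  with a(1) show "\<exists>a\<in>A. dist c a \<le> hausdorff_metric A B + hausdorff_metric B C" ..
qed

lemma hausdorff_metric_le_0_imp_eq: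
  assumes "A \<in> Kstar X" "B \<in> Kstar Y" "hausdorff_metric A B \<le> 0"
  shows "A = B"
  using hausdorff_metric_leD[OF assms] by auto

lemma Kstar_mono: "N \<subseteq> X \<Longrightarrow> Kstar N \<subseteq> Kstar X"
  by (auto simp: Kstar_def)

section \<open>Lipschitz maps on powers\<close>

lemma dist_le_max_dist: "i < m \<Longrightarrow> dist (x i) (y i) \<le> max_dist m x y"
  unfolding max_dist_def by (intro Max_ge) auto

lemma max_dist_le_iff: "1 \<le> m \<Longrightarrow> max_dist m x y \<le> t \<longleftrightarrow> (\<forall>i<m. dist (x i) (y i) \<le> t)"
  unfolding max_dist_def by (subst Max_le_iff) (auto simp: lessThan_empty_iff)

text \<open>The infimum defining \<open>Lip\<close> is itself a Lipschitz bound: for two points at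
  positive distance, the difference quotient is a lower bound of all admissible constants.\<close>

lemma lipschitz_bound_Lip:
  assumes "1 \<le> m" "\<exists>C. lipschitz_bound X m f C"
  shows "lipschitz_bound X m f (Lip X m f)"
proof -
  let ?B = "{C. lipschitz_bound X m f C}"
  have ne: "?B \<noteq> {}"
    using assms(2) by blast
  have "0 \<le> Lip X m f"
    unfolding Lip_def using ne by (intro cInf_greatest) (auto simp: lipschitz_bound_def)
  moreover have "dist (f x) (f y) \<le> Lip X m f * max_dist m x y"
    if "x \<in> cart_power X m" "y \<in> cart_power X m" for x y
  proof (cases "max_dist m x y = 0")
    case True
    \<comment> \<open>At distance 0 no quotient exists, but any finite bound already forces equal
      images.\<close>
    with that assms(2) show ?thesis
      by (fastforce simp: lipschitz_bound_def)
  next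
    case False
    moreover have "0 \<le> max_dist m x y"
      using dist_le_max_dist[of 0 m x y] assms(1) zero_le_dist[of "x 0" "y 0"] by linarith
    ultimately have pos: "0 < max_dist m x y"
      by simp
    have "dist (f x) (f y) / max_dist m x y \<le> Lip X m f"
      unfolding Lip_def using ne that pos
      by (intro cInf_greatest) (auto simp: lipschitz_bound_def pos_divide_le_eq)
    with pos show ?thesis
      by (simp add: pos_divide_le_eq)
  qed
  ultimately show ?thesis
    by (auto simp: lipschitz_bound_def)
qed

lemma lipschitz_bound_mono:
  assumes "1 \<le> m" "lipschitz_bound X m f C" "C \<le> D"
  shows "lipschitz_bound X m f D"
proof -
  have "0 \<le> max_dist m x y" for x y :: "nat \<Rightarrow> 'a"
    using dist_le_max_dist[of 0 m x y] assms(1) zero_le_dist[of "x 0" "y 0"] by linarith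
  then have "C * max_dist m x y \<le> D * max_dist m x y" for x y :: "nat \<Rightarrow> 'a"
    using assms(3) by (intro mult_right_mono)
  then show ?thesis
    using assms(2,3) unfolding lipschitz_bound_def by (meson order_trans)
qed

text \<open>Tychonoff's theorem: outside \<open>I\<close> an extensional function can only take the
  value \<open>undefined\<close>, so \<open>PiE I K\<close> is a full product whose remaining
  factors are singletons.\<close>

lemma compact_PiE:
  fixes K :: "'i \<Rightarrow> 'a::topological_space set"
  assumes "\<And>i. i \<in> I \<Longrightarrow> compact (K i)"
  shows "compact (PiE I K)"
proof -
  have "PiE I K = PiE UNIV (\<lambda>i. if i \<in> I then K i else {undefined})"
    by (fastforce simp: PiE_iff extensional_def split: if_splits)
  moreover have "compactin (product_topology (\<lambda>i. euclidean) UNIV)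
    (PiE UNIV (\<lambda>i. if i \<in> I then K i else {undefined}))"
    using assms by (simp add: compactin_PiE)
  ultimately show ?thesis
    by (simp add: euclidean_product_topology)
qed

text \<open>Continuity here refers to the product topology on functions, the one in which
  \<open>compact_PiE\<close> gives compactness. The maximum metric is dominated by the sum of the
  coordinate distances, which tends to 0 by continuity of the coordinates.\<close>

lemma continuous_on_lipschitz_bound:
  fixes f :: "(nat \<Rightarrow> 'a::metric_space) \<Rightarrow> 'a"
  assumes "1 \<le> m" "lipschitz_bound X m f C"
  shows "continuous_on (cart_power X m) f"
proof -
  have "(f \<longlongrightarrow> f x) (at x within cart_power X m)" if x: "x \<in> cart_power X m" for x
  proof -
    have "dist (f y) (f x) \<le> C * (\<Sum>i<m. dist (y i) (x i))" if y: "y \<in> cart_power X m" for y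
    proof -
      have "dist (y i) (x i) \<le> (\<Sum>i<m. dist (y i) (x i))" if "i < m" for i
        using that by (intro member_le_sum) auto
      then have "max_dist m y x \<le> (\<Sum>i<m. dist (y i) (x i))"
        using assms(1) by (simp add: max_dist_le_iff)
      then have "C * max_dist m y x \<le> C * (\<Sum>i<m. dist (y i) (x i))"
        using assms(2) by (intro mult_left_mono) (auto simp: lipschitz_bound_def)
      then show ?thesis
        using assms(2) x y unfolding lipschitz_bound_def by (meson order_trans)
    qed
    then have le: "\<forall>\<^sub>F y in at x within cart_power X m.
        dist (f y) (f x) \<le> C * (\<Sum>i<m. dist (y i) (x i))"
      by (auto simp: eventually_at_filter)
    have coord: "((\<lambda>y. y i) \<longlongrightarrow> x i) (at x within cart_power X m)" for i
    proof -
      have "continuous_on (cart_power X m) (\<lambda>y. y i)"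
        by (rule continuous_on_subset[OF continuous_on_product_coordinates subset_UNIV])
      with x show ?thesis
        by (simp add: continuous_on_def)
    qed
    have "((\<lambda>y. C * (\<Sum>i<m. dist (y i) (x i))) \<longlongrightarrow> C * (\<Sum>i<m. dist (x i) (x i)))
        (at x within cart_power X m)"
      by (intro tendsto_intros coord)
    then have "((\<lambda>y. C * (\<Sum>i<m. dist (y i) (x i))) \<longlongrightarrow> 0) (at x within cart_power X m)"
      by simp
    then have "((\<lambda>y. dist (f y) (f x)) \<longlongrightarrow> 0) (at x within cart_power X m)"
      by (rule tendsto_sandwich[OF always_eventually le tendsto_const, rotated 1]) simp
    then show ?thesis
      by (rule iffD2[OF tendsto_dist_iff])
  qed
  then show ?thesis
    by (simp add: continuous_on_def)
qed

section \<open>The attractor of a contractive system\<close>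

text \<open>A common bound \<alpha> as a parameter keeps the infimum in \<open>Lip\<close> out of
  the arguments; \<open>contractive_gifs_factor\<close> later supplies the instance
  \<open>gifs_factor S\<close>.\<close>

locale contractive_gifs =
  fixes S :: "'a::metric_space gifs" and \<alpha> :: real
  assumes complete_space: "complete (gifs_space S)"
    and order_pos: "1 \<le> gifs_order S"
    and num_pos: "1 \<le> gifs_num S"
    and maps_into: "\<And>j. j \<in> {1..gifs_num S} \<Longrightarrow>
      gifs_map S j \<in> cart_power (gifs_space S) (gifs_order S) \<rightarrow> gifs_space S"
    and lipschitz: "\<And>j. j \<in> {1..gifs_num S} \<Longrightarrow>
      lipschitz_bound (gifs_space S) (gifs_order S) (gifs_map S j) \<alpha>"
    and factor_nonneg: "0 \<le> \<alpha>"
    and factor_less_1: "\<alpha> < 1"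
begin

abbreviation "X \<equiv> gifs_space S"
abbreviation "m \<equiv> gifs_order S"
abbreviation "F \<equiv> gifs_op_diag S"

section \<open>Contraction of the operator in the Hausdorff metric\<close>

lemma PiE_subset_cart_power:
  assumes "\<And>i. i < m \<Longrightarrow> K i \<in> Kstar X"
  shows "(\<Pi>\<^sub>E i\<in>{..<m}. K i) \<subseteq> cart_power X m"
  using assms unfolding cart_power_def Kstar_def by (intro PiE_mono) auto

lemma gifs_op_Kstar:
  assumes "\<And>i. i < m \<Longrightarrow> K i \<in> Kstar X"
  shows "gifs_op S K \<in> Kstar X"
proof -
  let ?P = "\<Pi>\<^sub>E i\<in>{..<m}. K i"
  note sub = PiE_subset_cart_power[of K, OF assms]
  have "compact (gifs_map S j ` ?P)" if "j \<in> {1..gifs_num S}" for j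
    using assms sub continuous_on_lipschitz_bound[OF order_pos lipschitz[OF that]]
    by (intro compact_continuous_image compact_PiE)
       (auto simp: Kstar_def intro: continuous_on_subset)
  then have "compact (gifs_op S K)"
    unfolding gifs_op_def by (intro compact_UN) auto
  moreover have "gifs_op S K \<subseteq> X"
    unfolding gifs_op_def using maps_into sub by blast
  moreover have "?P \<noteq> {}"
    using assms by (auto simp: PiE_eq_empty_iff Kstar_def)
  then have "gifs_op S K \<noteq> {}"
    unfolding gifs_op_def using num_pos by fastforce
  ultimately show ?thesis
    by (simp add: Kstar_def)
qed

text \<open>Each coordinate of a preimage of \<open>a\<close> is moved to a nearby point of
  \<open>L i\<close>, and the same map is applied. This is one half of the Hausdorff estimate;
  exchanging \<open>K\<close> and \<open>L\<close> gives the other.\<close>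

lemma gifs_op_approx:
  assumes "\<And>i. i < m \<Longrightarrow> K i \<in> Kstar X" "\<And>i. i < m \<Longrightarrow> L i \<in> Kstar X"
    and close: "\<And>i x. i < m \<Longrightarrow> x \<in> K i \<Longrightarrow> \<exists>y\<in>L i. dist x y \<le> t"
    and "a \<in> gifs_op S K"
  shows "\<exists>b\<in>gifs_op S L. dist a b \<le> \<alpha> * t"
proof -
  obtain j x where j: "j \<in> {1..gifs_num S}" and x: "x \<in> (\<Pi>\<^sub>E i\<in>{..<m}. K i)"
    and a: "a = gifs_map S j x"
    using assms(4) by (auto simp: gifs_op_def)
  have "\<forall>i\<in>{..<m}. \<exists>y\<in>L i. dist (x i) y \<le> t"
    using close x by (auto simp: PiE_iff)
  then obtain y where y: "\<forall>i\<in>{..<m}. y i \<in> L i \<and> dist (x i) (y i) \<le> t"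
    by metis
  \<comment> \<open>Points of the product must be \<open>undefined\<close> outside
    \<open>{..<m}\<close>, hence the restriction.\<close>
  let ?y = "restrict y {..<m}"
  have y': "?y \<in> (\<Pi>\<^sub>E i\<in>{..<m}. L i)"
    using y by auto
  have "max_dist m x ?y \<le> t"
    using y order_pos by (simp add: max_dist_le_iff)
  then have "\<alpha> * max_dist m x ?y \<le> \<alpha> * t"
    using factor_nonneg by (intro mult_left_mono)
  moreover have "dist a (gifs_map S j ?y) \<le> \<alpha> * max_dist m x ?y"
    using lipschitz[OF j] x y' PiE_subset_cart_power[of K, OF assms(1)]
      PiE_subset_cart_power[of L, OF assms(2)] unfolding a lipschitz_bound_def by blast
  moreover have "gifs_map S j ?y \<in> gifs_op S L"
    unfolding gifs_op_def using j y' by blast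
  ultimately show ?thesis
    by force
qed

text \<open>The arguments may differ from coordinate to coordinate because an orbit of order
  \<open>m\<close> feeds \<open>m\<close> successive sets into the operator.\<close>

lemma hausdorff_metric_gifs_op_le:
  assumes K: "\<And>i. i < m \<Longrightarrow> K i \<in> Kstar X" and L: "\<And>i. i < m \<Longrightarrow> L i \<in> Kstar X"
    and t: "\<And>i. i < m \<Longrightarrow> hausdorff_metric (K i) (L i) \<le> t"
  shows "hausdorff_metric (gifs_op S K) (gifs_op S L) \<le> \<alpha> * t"
proof -
  have KL: "\<exists>y\<in>L i. dist x y \<le> t" if "i < m" "x \<in> K i" for i x
    by (rule hausdorff_metric_leD(1)[OF K L t]) (rule that)+
  have LK: "\<exists>y\<in>K i. dist x y \<le> t" if "i < m" "x \<in> L i" for i x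
    by (rule hausdorff_metric_leD(2)[OF K L t]) (rule that)+
  show ?thesis
    by (rule hausdorff_metric_leI[OF gifs_op_Kstar[OF K] gifs_op_Kstar[OF L]
          gifs_op_approx[OF K L KL] gifs_op_approx[OF L K LK]])
qed

lemma F_Kstar: "K \<in> Kstar X \<Longrightarrow> F K \<in> Kstar X"
  by (simp add: gifs_op_diag_def gifs_op_Kstar)

lemma F_pow_Kstar: "K \<in> Kstar X \<Longrightarrow> (F ^^ n) K \<in> Kstar X"
  by (induction n) (auto simp: F_Kstar)

lemma hausdorff_metric_F_le:
  "K \<in> Kstar X \<Longrightarrow> L \<in> Kstar X \<Longrightarrow>
    hausdorff_metric (F K) (F L) \<le> \<alpha> * hausdorff_metric K L"
  unfolding gifs_op_diag_def by (intro hausdorff_metric_gifs_op_le) auto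

lemma hausdorff_metric_F_pow_le:
  assumes "K \<in> Kstar X" "L \<in> Kstar X"
  shows "hausdorff_metric ((F ^^ n) K) ((F ^^ n) L) \<le> \<alpha> ^ n * hausdorff_metric K L"
proof (induction n)
  case (Suc n)
  have "hausdorff_metric ((F ^^ Suc n) K) ((F ^^ Suc n) L)
      \<le> \<alpha> * hausdorff_metric ((F ^^ n) K) ((F ^^ n) L)"
    using hausdorff_metric_F_le F_pow_Kstar assms by simp
  also have "\<dots> \<le> \<alpha> * (\<alpha> ^ n * hausdorff_metric K L)"
    using Suc factor_nonneg by (intro mult_left_mono)
  finally show ?case
    by (simp add: mult.assoc)
qed simp

section \<open>Existence, attraction and uniqueness of the compact invariant set\<close>

lemma F_mono:
  assumes "K \<subseteq> L"
  shows "F K \<subseteq> F L"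
proof -
  have "(\<Pi>\<^sub>E i\<in>{..<m}. K) \<subseteq> (\<Pi>\<^sub>E i\<in>{..<m}. L)"
    using assms by (rule PiE_mono)
  then show ?thesis
    unfolding gifs_op_diag_def gifs_op_def by (rule UN_mono[OF order_refl image_mono])
qed

lemma finite_F:
  assumes "finite K"
  shows "finite (F K)"
proof -
  have "finite (\<Pi>\<^sub>E i\<in>{..<m}. K)"
    by (rule finite_PiE[OF finite_lessThan assms])
  then show ?thesis
    unfolding gifs_op_diag_def gifs_op_def
    by (rule finite_UN_I[OF finite_atLeastAtMost finite_imageI])
qed

text \<open>The diagonal \<open>d\<close> does not increase distances, so the first map composed
  with it is a contraction of the complete space, to which Banach's theorem applies.\<close>

lemma ex_diagonal_fixed_point:
  assumes "X \<noteq> {}"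
  obtains x where "x \<in> X" "x \<in> F {x}"
proof -
  define d where "d x = (\<lambda>i\<in>{..<m}. x)" for x :: 'a
  let ?f = "\<lambda>x. gifs_map S 1 (d x)"
  have one: "1 \<in> {1..gifs_num S}"
    using num_pos by simp
  have d: "d x \<in> cart_power X m" if "x \<in> X" for x
    using that by (auto simp: cart_power_def d_def)
  have "dist (?f x) (?f y) \<le> \<alpha> * dist x y" if "x \<in> X" "y \<in> X" for x y
  proof -
    have "max_dist m (d x) (d y) \<le> dist x y"
      using order_pos by (simp add: max_dist_le_iff d_def)
    then have "\<alpha> * max_dist m (d x) (d y) \<le> \<alpha> * dist x y"
      using factor_nonneg by (intro mult_left_mono)
    then show ?thesis
      using lipschitz[OF one] d that unfolding lipschitz_bound_def by (meson order_trans)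
  qed
  moreover have "?f ` X \<subseteq> X"
    using maps_into[OF one] d by blast
  ultimately obtain x where x: "x \<in> X" "?f x = x"
    using Banach_fix[OF complete_space assms factor_nonneg factor_less_1] by blast
  have "d x \<in> (\<Pi>\<^sub>E i\<in>{..<m}. {x})"
    by (auto simp: d_def)
  then have "?f x \<in> F {x}"
    unfolding gifs_op_diag_def gifs_op_def using one by blast
  with x that show thesis
    by simp
qed

lemma factor_pow_tendsto_0: "(\<lambda>n. \<alpha> ^ n * c) \<longlonglongrightarrow> 0"
  using LIMSEQ_power_zero[of \<alpha>] factor_nonneg factor_less_1
  by (intro tendsto_mult_left_zero) auto

text \<open>The finite sets \<open>K n\<close> serve as nets that make the closure \<open>A\<close>
  totally bounded. Invariance holds because \<open>F A\<close> is close to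
  \<open>F (K n) = K (Suc n)\<close>, which is close to \<open>A\<close>.\<close>

lemma ex_invariant_set:
  assumes "X \<noteq> {}"
  obtains A where "A \<in> Kstar X" "F A = A"
proof -
  obtain x where x: "x \<in> X" "x \<in> F {x}"
    using ex_diagonal_fixed_point[OF assms] .
  define K where "K n = (F ^^ n) {x}" for n
  have Suc_K: "K (Suc n) = F (K n)" for n
    by (simp add: K_def)
  have x_Kstar: "{x} \<in> Kstar X"
    using x by (simp add: Kstar_def)
  then have K: "K n \<in> Kstar X" for n
    unfolding K_def by (rule F_pow_Kstar)
  \<comment> \<open>The inclusion of \<open>{x}\<close> in \<open>F {x}\<close> is propagated by
    monotonicity.\<close>
  have "K n \<subseteq> K (Suc n)" for n
  proof (induction n)
    case 0
    show ?case using x by (simp add: K_def)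
  next
    case (Suc n)
    then show ?case using F_mono[OF Suc] by (simp only: Suc_K)
  qed
  then have incr: "K i \<subseteq> K j" if "i \<le> j" for i j
    using that by (rule lift_Suc_mono_le)
  have fin: "finite (K n)" for n
    by (induction n) (auto simp: K_def finite_F)
  \<comment> \<open>\<open>D\<close> sums the geometric series of successive distances. Being a
    fixed point of \<open>t \<mapsto> hausdorff_metric (K 0) (K 1) + \<alpha> * t\<close>, it passes
    through the induction for \<open>dist_0\<close> unchanged.\<close>
  define D where "D = hausdorff_metric (K 0) (K 1) / (1 - \<alpha>)"
  have D: "D = hausdorff_metric (K 0) (K 1) + \<alpha> * D"
    using factor_less_1 by (simp add: D_def field_simps)
  have D_nonneg: "0 \<le> D"
    using hausdorff_metric_nonneg[OF K K] factor_less_1 by (simp add: D_def)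
  have dist_0: "hausdorff_metric (K 0) (K k) \<le> D" for k
  proof (induction k)
    case 0
    have "hausdorff_metric (K 0) (K 0) \<le> 0"
      by (rule hausdorff_metric_leI[OF K K]) (auto intro: bexI[rotated])
    with D_nonneg show ?case by linarith
  next
    case (Suc k)
    have "hausdorff_metric (K 1) (K (Suc k)) \<le> \<alpha> * hausdorff_metric (K 0) (K k)"
      using hausdorff_metric_F_le[OF K K, of 0 k] by (simp add: Suc_K)
    also have "\<dots> \<le> \<alpha> * D"
      using Suc factor_nonneg by (intro mult_left_mono)
    finally show ?case
      using hausdorff_metric_triangle[OF K K K, of 0 "Suc k" 1] D by linarith
  qed
  \<comment> \<open>Applying \<open>F ^^ n\<close> to the pair \<open>K 0\<close>,
    \<open>K k\<close> gives \<open>K n\<close>, \<open>K (n + k)\<close>.\<close>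
  have dist_n: "hausdorff_metric (K n) (K (n + k)) \<le> \<alpha> ^ n * D" for n k
  proof -
    have "hausdorff_metric (K n) (K (n + k)) \<le> \<alpha> ^ n * hausdorff_metric (K 0) (K k)"
      using hausdorff_metric_F_pow_le[OF K K, of n 0 k] by (simp add: K_def funpow_add)
    also have "\<dots> \<le> \<alpha> ^ n * D"
      using dist_0 factor_nonneg by (intro mult_left_mono) auto
    finally show ?thesis .
  qed
  define U where "U = (\<Union>n. K n)"
  define A where "A = closure U"
  have K_A: "K n \<subseteq> A" for n
    unfolding A_def U_def by (rule order_trans[OF UN_upper[OF UNIV_I] closure_subset])
  \<comment> \<open>The slack \<open>e\<close> pays for passing from the closure to a point
    \<open>u\<close> of the union; since the sets increase, \<open>u\<close> lies in some
    \<open>K (n + k)\<close>.\<close>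
  have near: "\<exists>b\<in>K n. dist a b < \<alpha> ^ n * D + e" if "a \<in> A" "e > 0" for a e n
  proof -
    obtain u where u: "u \<in> U" "dist u a < e"
      using \<open>a \<in> A\<close> \<open>e > 0\<close> unfolding A_def closure_approachable by blast
    then obtain k where k: "u \<in> K k"
      by (auto simp: U_def)
    then have "u \<in> K (n + k)"
      using incr[of k "n + k"] by auto
    then obtain b where "b \<in> K n" "dist u b \<le> \<alpha> ^ n * D"
      using hausdorff_metric_leD(2)[OF K K dist_n] by blast
    with u show ?thesis
      using dist_triangle[of a b u] by (force simp: dist_commute)
  qed
  have near_eventually: "\<exists>n. \<forall>k\<ge>n. \<forall>a\<in>A. \<exists>b\<in>K k. dist a b < e" if "e > 0" for e
  proof -
    have "\<forall>\<^sub>F n in sequentially. \<alpha> ^ n * D < e / 2"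
      using factor_pow_tendsto_0 that by (intro order_tendstoD(2)[of _ 0]) auto
    then obtain n where n: "\<And>k. k \<ge> n \<Longrightarrow> \<alpha> ^ k * D < e / 2"
      by (auto simp: eventually_sequentially)
    have "\<exists>b\<in>K k. dist a b < e" if "k \<ge> n" "a \<in> A" for k a
      using near[OF that(2), of "e / 2" k] n[OF that(1)] \<open>e > 0\<close> by force
    then show ?thesis
      by blast
  qed
  have "A \<subseteq> X"
    unfolding A_def U_def using K complete_imp_closed[OF complete_space]
    by (intro closure_minimal) (auto simp: Kstar_def)
  then have "complete A"
    using complete_space by (intro complete_closed_subset[of A X]) (auto simp: A_def)
  moreover have "\<exists>k. finite k \<and> A \<subseteq> (\<Union>x\<in>k. ball x e)" if "e > 0" for e
  proof -
    obtain n where "\<forall>a\<in>A. \<exists>b\<in>K n. dist a b < e"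
      using near_eventually[OF \<open>e > 0\<close>] by blast
    then have "A \<subseteq> (\<Union>x\<in>K n. ball x e)"
      by (force simp: dist_commute)
    with fin show ?thesis
      by blast
  qed
  ultimately have "compact A"
    by (simp add: compact_eq_totally_bounded)
  moreover have "A \<noteq> {}"
    using K_A[of 0] by (auto simp: K_def)
  ultimately have A: "A \<in> Kstar X"
    using \<open>A \<subseteq> X\<close> by (simp add: Kstar_def)
  \<comment> \<open>Half of \<open>e\<close> bounds the distance from \<open>F A\<close> to
    \<open>K (Suc n)\<close>, the other half that from \<open>K (Suc n)\<close> to
    \<open>A\<close>.\<close>
  have "hausdorff_metric (F A) A \<le> 0 + e" if "e > 0" for e
  proof -
    obtain n where n: "\<And>k. k \<ge> n \<Longrightarrow> \<forall>a\<in>A. \<exists>b\<in>K k. dist a b < e / 2"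
      using near_eventually[of "e / 2"] \<open>e > 0\<close> by auto
    have le: "hausdorff_metric A (K k) \<le> e / 2" if "k \<ge> n" for k
    proof -
      have "\<exists>b\<in>K k. dist a b \<le> e / 2" if "a \<in> A" for a
        using n[OF \<open>k \<ge> n\<close>] that by (blast intro: less_imp_le)
      moreover have "\<exists>a\<in>A. dist b a \<le> e / 2" if "b \<in> K k" for b
        using that K_A[of k] \<open>e > 0\<close> by (intro bexI[of _ b]) auto
      ultimately show ?thesis
        by (rule hausdorff_metric_leI[OF A K])
    qed
    have "hausdorff_metric (F A) (K (Suc n)) \<le> \<alpha> * hausdorff_metric A (K n)"
      using hausdorff_metric_F_le[OF A K] by (simp add: Suc_K)
    also have "\<dots> \<le> 1 * hausdorff_metric A (K n)"
      using factor_less_1 hausdorff_metric_nonneg[OF A K] by (intro mult_right_mono) auto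
    finally show ?thesis
      using hausdorff_metric_triangle[OF F_Kstar[OF A] K A, of "Suc n"] le[of n] le[of "Suc n"]
      by (simp add: hausdorff_metric_commute)
  qed
  then have "hausdorff_metric (F A) A \<le> 0"
    by (rule field_le_epsilon)
  then have "F A = A"
    by (rule hausdorff_metric_le_0_imp_eq[OF F_Kstar[OF A] A])
  with A that show thesis
    by blast
qed

text \<open>A new set depends on the \<open>m\<close> preceding ones, so one factor \<alpha> is
  gained per block of \<open>m\<close> steps; this explains the exponent \<open>k div m\<close> in
  \<open>bound\<close>.\<close>

lemma orbit_tendsto:
  assumes A: "A \<in> Kstar X" "F A = A"
    and init: "\<And>i. i < m \<Longrightarrow> K i \<in> Kstar X"
    and step: "\<And>k. K (k + m) = gifs_op S (\<lambda>i. K (k + i))"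
  shows "(\<lambda>k. hausdorff_metric (K k) A) \<longlonglongrightarrow> 0"
proof -
  have K: "K k \<in> Kstar X" for k
  proof (induction k rule: less_induct)
    case (less k)
    show ?case
    proof (cases "k < m")
      case False
      then have "K k = gifs_op S (\<lambda>i. K (k - m + i))"
        using step[of "k - m"] by simp
      also have "\<dots> \<in> Kstar X"
        using less False by (intro gifs_op_Kstar) auto
      finally show ?thesis .
    qed (use init in blast)
  qed
  define M where "M = Max ((\<lambda>i. hausdorff_metric (K i) A) ` {..<m})"
  have M: "hausdorff_metric (K i) A \<le> M" if "i < m" for i
    unfolding M_def using that by (intro Max_ge) auto
  have M_nonneg: "0 \<le> M"
    using M[of 0] order_pos hausdorff_metric_nonneg[OF K A(1), of 0] by simp
  have bound: "hausdorff_metric (K k) A \<le> \<alpha> ^ (k div m) * M" for k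
  proof (induction k rule: less_induct)
    case (less k)
    show ?case
    proof (cases "k < m")
      case True
      with M show ?thesis by simp
    next
      case False
      define l where "l = k - m"
      have k: "k = l + m"
        using False by (simp add: l_def)
      \<comment> \<open>The oldest argument \<open>K l\<close> carries the weakest bound, which
        therefore serves for all \<open>m\<close> arguments.\<close>
      have "hausdorff_metric (K (l + i)) A \<le> \<alpha> ^ (l div m) * M" if "i < m" for i
      proof -
        have "\<alpha> ^ ((l + i) div m) \<le> \<alpha> ^ (l div m)"
          using factor_nonneg factor_less_1 by (intro power_decreasing div_le_mono) auto
        then have "\<alpha> ^ ((l + i) div m) * M \<le> \<alpha> ^ (l div m) * M"
          using M_nonneg by (rule mult_right_mono)
        moreover have "hausdorff_metric (K (l + i)) A \<le> \<alpha> ^ ((l + i) div m) * M"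
          using that by (intro less) (simp add: k)
        ultimately show ?thesis by linarith
      qed
      then have "hausdorff_metric (gifs_op S (\<lambda>i. K (l + i))) (gifs_op S (\<lambda>_. A))
          \<le> \<alpha> * (\<alpha> ^ (l div m) * M)"
        using K A by (intro hausdorff_metric_gifs_op_le) auto
      moreover have "k div m = Suc (l div m)"
        using order_pos by (simp add: k)
      ultimately show ?thesis
        using step[of l] A(2) by (simp add: k gifs_op_diag_def mult.assoc)
    qed
  qed
  have "filterlim (\<lambda>k. k div m) sequentially sequentially"
    unfolding filterlim_at_top eventually_sequentially
  proof
    fix Z
    have "Z \<le> k div m" if "Z * m \<le> k" for k
      using that order_pos by (simp add: less_eq_div_iff_mult_less_eq)
    then show "\<exists>N. \<forall>k\<ge>N. Z \<le> k div m"
      by blast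
  qed
  then have "(\<lambda>k. \<alpha> ^ (k div m) * M) \<longlonglongrightarrow> 0"
    by (rule filterlim_compose[OF factor_pow_tendsto_0])
  then show ?thesis
    by (rule tendsto_sandwich[OF always_eventually always_eventually tendsto_const, rotated 2])
       (use bound hausdorff_metric_nonneg[OF K A(1)] in blast)+
qed

text \<open>This justifies the definite description in \<open>attractor\<close>: an invariant
  compact set attracts all orbits, and any other attractor must coincide with it.\<close>

lemma attractor_invariant:
  assumes "X \<noteq> {}"
  shows "attractor S \<in> Kstar X" "F (attractor S) = attractor S"
proof -
  obtain A where A: "A \<in> Kstar X" "F A = A"
    using ex_invariant_set[OF assms] .
  then have "is_attractor S A"
    unfolding is_attractor_def using orbit_tendsto[OF A]
    by (auto simp only: gifs_op_diag_def A)
  moreover have "B = A" if B: "is_attractor S B" for B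
  proof -
    have B': "B \<in> Kstar X" "F B = B"
      using B by (auto simp: is_attractor_def gifs_op_diag_def)
    \<comment> \<open>By its invariance, \<open>B\<close> repeated forever is an orbit, so it
      converges to \<open>A\<close>.\<close>
    have "(\<lambda>k::nat. hausdorff_metric B A) \<longlonglongrightarrow> 0"
      using B' by (intro orbit_tendsto[OF A, of "\<lambda>_. B"]) (simp_all add: gifs_op_diag_def)
    then have "hausdorff_metric B A = 0"
      by (simp add: LIMSEQ_const_iff)
    then show ?thesis
      using hausdorff_metric_le_0_imp_eq[OF B'(1) A(1)] by simp
  qed
  ultimately have "is_attractor S (attractor S)"
    unfolding attractor_def by (rule theI[of "is_attractor S"])
  then show "attractor S \<in> Kstar X" "F (attractor S) = attractor S"
    by (auto simp: is_attractor_def gifs_op_diag_def)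
qed

section \<open>Discretization\<close>

text \<open>The restriction in \<open>discretize\<close> disappears because all tuples from
  \<open>K\<close> lie in the power of \<open>N\<close>; a discrete step is thus an exact step
  followed by \<open>r\<close>.\<close>

lemma gifs_op_diag_discretize:
  assumes "K \<subseteq> N"
  shows "gifs_op_diag (discretize S N r) K = r ` F K"
proof -
  have "(\<Pi>\<^sub>E i\<in>{..<m}. K) \<subseteq> cart_power N m"
    unfolding cart_power_def using assms by (intro PiE_mono) auto
  then have "restrict (r \<circ> gifs_map S j) (cart_power N m) ` (\<Pi>\<^sub>E i\<in>{..<m}. K)
      = r ` gifs_map S j ` (\<Pi>\<^sub>E i\<in>{..<m}. K)" for j
    unfolding image_image by (intro image_cong) auto
  then show ?thesis
    by (simp add: gifs_op_diag_def gifs_op_def discretize_def image_UN)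
qed

lemma projection_image:
  assumes N: "proper_eps_net \<epsilon> X N" and r: "eps_projection \<epsilon> X N r" and K: "K \<in> Kstar X"
  shows "r ` K \<in> Kstar N" "hausdorff_metric (r ` K) K \<le> \<epsilon>"
proof -
  have near: "dist x (r x) \<le> \<epsilon>" if "x \<in> K" for x
    using r K that by (auto simp: eps_projection_def Kstar_def)
  have sub: "r ` K \<subseteq> N" "N \<subseteq> X"
    using r K N by (auto simp: eps_projection_def Kstar_def proper_eps_net_def eps_net_def)
  have "bounded K"
    using K by (simp add: Kstar_def compact_imp_bounded)
  then obtain c e where "\<forall>x\<in>K. dist c x \<le> e"
    unfolding bounded_def by blast
  then have "dist c (r x) \<le> e + \<epsilon>" if "x \<in> K" for x
    using near[OF that] that dist_triangle[of c "r x" x] by fastforce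
  then have "\<forall>y\<in>r ` K. dist c y \<le> e + \<epsilon>"
    by simp
  then have "bounded (r ` K)"
    unfolding bounded_def by blast
  then have "finite (r ` K \<inter> N)"
    using N sub unfolding proper_eps_net_def by (meson order_trans)
  then have "finite (r ` K)"
    using sub by (simp add: Int_absorb2)
  then show rK: "r ` K \<in> Kstar N"
    using sub K by (auto simp: Kstar_def finite_imp_compact)
  show "hausdorff_metric (r ` K) K \<le> \<epsilon>"
  proof (rule hausdorff_metric_leI[OF rK K])
    show "\<exists>x\<in>K. dist y x \<le> \<epsilon>" if "y \<in> r ` K" for y
      using near that by (auto simp: dist_commute)
    show "\<exists>y\<in>r ` K. dist x y \<le> \<epsilon>" if "x \<in> K" for x
      using near that by blast
  qed
qed

text \<open>Triangle inequality through \<open>F K\<close>: projecting costs \<epsilon>, while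
  \<open>F\<close> contracts towards its invariant set \<open>A\<close>.\<close>

lemma discretize_step:
  assumes N: "proper_eps_net \<epsilon> X N" and r: "eps_projection \<epsilon> X N r" and K: "K \<in> Kstar N"
    and A: "A \<in> Kstar X" "F A = A"
  shows "gifs_op_diag (discretize S N r) K \<in> Kstar N"
    and "hausdorff_metric (gifs_op_diag (discretize S N r) K) A \<le> \<epsilon> + \<alpha> * hausdorff_metric K A"
proof -
  have "K \<subseteq> N" and K': "K \<in> Kstar X"
    using K N by (auto simp: Kstar_def proper_eps_net_def eps_net_def)
  then have eq: "gifs_op_diag (discretize S N r) K = r ` F K"
    by (simp add: gifs_op_diag_discretize)
  note FK = F_Kstar[OF K']
  note rFK = projection_image[OF N r FK]
  show "gifs_op_diag (discretize S N r) K \<in> Kstar N"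
    using rFK(1) by (simp add: eq)
  have "hausdorff_metric (r ` F K) A \<le> hausdorff_metric (r ` F K) (F K) + hausdorff_metric (F K) A"
    by (rule hausdorff_metric_triangle[OF rFK(1) FK A(1)])
  also have "\<dots> \<le> \<epsilon> + \<alpha> * hausdorff_metric K A"
    using rFK(2) hausdorff_metric_F_le[OF K' A(1)] A(2) by simp
  finally show "hausdorff_metric (gifs_op_diag (discretize S N r) K) A
      \<le> \<epsilon> + \<alpha> * hausdorff_metric K A"
    by (simp add: eq)
qed

lemma discretize_pow:
  assumes N: "proper_eps_net \<epsilon> X N" and r: "eps_projection \<epsilon> X N r" and K: "K \<in> Kstar N"
    and A: "A \<in> Kstar X" "F A = A" and "0 \<le> \<epsilon>"
  defines "G \<equiv> gifs_op_diag (discretize S N r)"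
  shows "(G ^^ n) K \<in> Kstar N"
    and "hausdorff_metric ((G ^^ n) K) A \<le> \<epsilon> / (1 - \<alpha>) + \<alpha> ^ n * hausdorff_metric K A"
proof -
  show Gn: "(G ^^ n) K \<in> Kstar N" for n
    by (induction n) (auto simp: K G_def intro: discretize_step(1)[OF N r _ A])
  show "hausdorff_metric ((G ^^ n) K) A \<le> \<epsilon> / (1 - \<alpha>) + \<alpha> ^ n * hausdorff_metric K A"
  proof (induction n)
    case 0
    show ?case using factor_less_1 \<open>0 \<le> \<epsilon>\<close> by simp
  next
    case (Suc n)
    have "hausdorff_metric ((G ^^ Suc n) K) A \<le> \<epsilon> + \<alpha> * hausdorff_metric ((G ^^ n) K) A"
      using discretize_step(2)[OF N r Gn A] by (simp add: G_def)
    also have "\<dots> \<le> \<epsilon> + \<alpha> * (\<epsilon> / (1 - \<alpha>) + \<alpha> ^ n * hausdorff_metric K A)"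
      using Suc factor_nonneg by (intro add_left_mono mult_left_mono)
    \<comment> \<open>The value \<open>\<epsilon> / (1 - \<alpha>)\<close> is the fixed point of
      \<open>t \<mapsto> \<epsilon> + \<alpha> * t\<close>, so the constant term reproduces
      itself.\<close>
    also have "\<dots> = \<epsilon> / (1 - \<alpha>) + \<alpha> ^ Suc n * hausdorff_metric K A"
      using factor_less_1 by (simp add: field_simps)
    finally show ?case .
  qed
qed

end

section \<open>From generalized Banach contractions to the final estimate\<close>

lemma contractive_gifs_factor:
  assumes "complete (gifs_space S)" "is_GIFS S"
    and gbc: "\<forall>j\<in>{1..gifs_num S}. generalized_Banach_contraction (gifs_space S) (gifs_order S) (gifs_map S j)"
  shows "contractive_gifs S (gifs_factor S)"
proof -
  let ?J = "{1..gifs_num S}" and ?L = "\<lambda>j. Lip (gifs_space S) (gifs_order S) (gifs_map S j)"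
  have pos: "1 \<le> gifs_order S" "1 \<le> gifs_num S"
    using assms(2) by (auto simp: is_GIFS_def)
  have Lip: "lipschitz_bound (gifs_space S) (gifs_order S) (gifs_map S j) (?L j)" if "j \<in> ?J" for j
    using gbc that pos by (intro lipschitz_bound_Lip) (auto simp: generalized_Banach_contraction_def)
  have le: "?L j \<le> gifs_factor S" if "j \<in> ?J" for j
    unfolding gifs_factor_def using that by (intro Max_ge) auto
  have "0 \<le> ?L 1"
    using Lip[of 1] pos by (simp add: lipschitz_bound_def)
  then have "0 \<le> gifs_factor S"
    using le[of 1] pos by simp
  \<comment> \<open>A maximum of finitely many constants below 1 stays below 1.\<close>
  moreover have "gifs_factor S < 1"
    unfolding gifs_factor_def using gbc pos
    by (subst Max_less_iff) (auto simp: generalized_Banach_contraction_def)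
  ultimately show ?thesis
    using assms(1) pos gbc lipschitz_bound_mono[OF pos(1) Lip le]
    by unfold_locales (auto simp: generalized_Banach_contraction_def)
qed

theorem theorem10p2:
  fixes S :: "'a::metric_space gifs" and N :: "'a set" and r :: "'a \<Rightarrow> 'a" and \<epsilon> :: real
  assumes "complete (gifs_space S)"
    and "is_GIFS S"
    and "\<forall>j\<in>{1..gifs_num S}. generalized_Banach_contraction (gifs_space S) (gifs_order S) (gifs_map S j)"
    and "0 < \<epsilon>"
    and "proper_eps_net \<epsilon> (gifs_space S) N"
    and "eps_projection \<epsilon> (gifs_space S) N r"
  shows "\<forall>K\<in>Kstar N.
     (\<forall>n::nat. hausdorff_metric ((gifs_op_diag (discretize S N r) ^^ n) K) (attractor S)
        \<le> 5 * \<epsilon> / (1 - gifs_factor S) + gifs_factor S ^ n * hausdorff_metric K (attractor S)) \<and>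
     (\<exists>n0::nat. \<forall>n\<ge>n0.
        attractor_with_resolution S (6 * \<epsilon> / (1 - gifs_factor S))
          ((gifs_op_diag (discretize S N r) ^^ n) K))"
proof
  fix K assume K: "K \<in> Kstar N"
  interpret contractive_gifs S "gifs_factor S"
    using assms(1-3) by (rule contractive_gifs_factor)
  let ?\<alpha> = "gifs_factor S" and ?A = "attractor S" and ?G = "gifs_op_diag (discretize S N r)"
  have "N \<subseteq> X"
    using assms(5) by (simp add: proper_eps_net_def eps_net_def)
  \<comment> \<open>Existence of the attractor requires a nonempty space; the given \<open>K\<close>
    provides a point.\<close>
  with K have "X \<noteq> {}"
    by (auto simp: Kstar_def)
  note pow = discretize_pow[OF assms(5,6) K attractor_invariant[OF this] less_imp_le[OF assms(4)]]
  have "\<epsilon> / (1 - ?\<alpha>) \<le> 5 * \<epsilon> / (1 - ?\<alpha>)"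
    using assms(4) factor_less_1 by (intro divide_right_mono) auto
  then have bound: "hausdorff_metric ((?G ^^ n) K) ?A
      \<le> 5 * \<epsilon> / (1 - ?\<alpha>) + ?\<alpha> ^ n * hausdorff_metric K ?A" for n
    using pow(2)[of n] by linarith
  have pos: "0 < \<epsilon> / (1 - ?\<alpha>)"
    using assms(4) factor_less_1 by simp
  \<comment> \<open>The gap between the constants 5 and 6 leaves
    \<open>\<epsilon> / (1 - ?\<alpha>)\<close> for the decaying term; \<open>n0\<close> is chosen
    so that this suffices.\<close>
  then have "\<forall>\<^sub>F n in sequentially. ?\<alpha> ^ n * hausdorff_metric K ?A < \<epsilon> / (1 - ?\<alpha>)"
    by (rule order_tendstoD(2)[OF factor_pow_tendsto_0])
  then obtain n0 where n0: "\<And>n. n \<ge> n0 \<Longrightarrow> ?\<alpha> ^ n * hausdorff_metric K ?A < \<epsilon> / (1 - ?\<alpha>)"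
    by (auto simp: eventually_sequentially)
  have "attractor_with_resolution S (6 * \<epsilon> / (1 - ?\<alpha>)) ((?G ^^ n) K)" if "n \<ge> n0" for n
    unfolding attractor_with_resolution_def
  proof (intro conjI)
    show "0 < 6 * \<epsilon> / (1 - ?\<alpha>)"
      using assms(4) factor_less_1 by simp
    show "(?G ^^ n) K \<in> Kstar X"
      using pow(1) Kstar_mono[OF \<open>N \<subseteq> X\<close>] by blast
    have "6 * \<epsilon> / (1 - ?\<alpha>) = 5 * \<epsilon> / (1 - ?\<alpha>) + \<epsilon> / (1 - ?\<alpha>)"
      by (simp add: add_divide_distrib[symmetric])
    then show "hausdorff_metric ((?G ^^ n) K) ?A \<le> 6 * \<epsilon> / (1 - ?\<alpha>)"
      using bound[of n] n0[OF that] by linarith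
  qed
  with bound show "(\<forall>n. hausdorff_metric ((?G ^^ n) K) ?A
        \<le> 5 * \<epsilon> / (1 - ?\<alpha>) + ?\<alpha> ^ n * hausdorff_metric K ?A) \<and>
      (\<exists>n0. \<forall>n\<ge>n0. attractor_with_resolution S (6 * \<epsilon> / (1 - ?\<alpha>)) ((?G ^^ n) K))"
    by blast
qed

end
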